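(* For all integers $p,q\ge1$, $n,m\ge0$ and all complex numbers $z,z',w,w',\gamma$, $$H_{n,m}^{(p,q)}\left(\frac{z+z'}{2^{1/(2p)}},\frac{w+w'}{2^{1/(2q)}}\,\bigg|\,\gamma\right)=2^{-\left(\frac{n}{2p}+\frac{m}{2q}\right)}\sum_{k=0}^{n}\sum_{j=0}^{m}\binom{n}{k}\binom{m}{j}H_{k,j}^{(p,q)}(z,w|\gamma)\,H_{n-k,m-j}^{(p,q)}(z',w'|\gamma).$$
   Context: For integers $p,q\ge1$, $n,m\ge0$ and complex $z,w,\gamma$, $$H_{n,m}^{(p,q)}(z,w|\gamma)= n!\,m!\sum_{k=0}^{\lfloor n/p\rfloor\wedge\lfloor m/q\rfloor}\frac{\gamma^k}{k!}\frac{z^{n-pk}}{(n-pk)!}\frac{w^{m-qk}}{(m-qk)!},$$ where $a\wedge b=\min\{a,b\}$. Fractional powers of $2$ denote the positive real ones. *)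

theory Defs
  imports Complex_Main
begin

definition H :: "nat \<Rightarrow> nat \<Rightarrow> nat \<Rightarrow> nat \<Rightarrow> complex \<Rightarrow> complex \<Rightarrow> complex \<Rightarrow> complex" where
  "H p q n m z w \<gamma> =
     fact n * fact m *
     (\<Sum>k=0..min (n div p) (m div q).
        \<gamma> ^ k / fact k
        * (z ^ (n - p * k) / fact (n - p * k))
        * (w ^ (m - q * k) / fact (m - q * k)))"

end

theory Submission
  imports Defs "HOL-Computational_Algebra.Formal_Power_Series"
begin

unbundle fps_syntax

text \<open>
  With respect to \<open>u\<^sup>n v\<^sup>m / (n! m!)\<close> the polynomials \<open>H\<close> have the generating function
  \<open>exp (z u + w v + \<gamma> u\<^sup>p v\<^sup>q)\<close>. A product of two such series adds the parameters
  \<open>z\<close>, \<open>w\<close> and \<open>\<gamma>\<close>, so the double sum is \<open>H\<close> at \<open>(z + z', w + w' | 2 \<gamma>)\<close>. Rescaling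
  \<open>u\<close> by \<open>2 powr (1 / (2 p))\<close> and \<open>v\<close> by \<open>2 powr (1 / (2 q))\<close> absorbs the factor 2.
\<close>

lemma fps_compose_X_power_nth:
  fixes f :: "'a::comm_ring_1 fps"
  assumes "p \<ge> 1"
  shows "(f oo fps_X ^ p) $ i = (if p dvd i then f $ (i div p) else 0)"
proof -
  have "(f oo fps_X ^ p) $ i = (\<Sum>k=0..i. if p * k = i then f $ k else 0)"
    by (auto simp: fps_compose_nth power_mult [symmetric] fps_X_power_nth intro!: sum.cong)
  also have "\<dots> = (\<Sum>k=0..i. if k = i div p then (if p dvd i then f $ k else 0) else 0)"
    using assms by (intro sum.cong) auto
  also have "\<dots> = (if p dvd i then f $ (i div p) else 0)"
    by (simp add: sum.delta)
  finally show ?thesis .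
qed

text \<open>In the Cauchy product only indices \<open>i = p * k\<close> survive, since
  \<open>f oo fps_X ^ p\<close> lives on multiples of \<open>p\<close>. This produces the bound
  \<open>n div p\<close> and the exponents \<open>n - p * k\<close> of \<open>H\<close>.\<close>

lemma fps_mult_compose_X_power_nth:
  fixes f g :: "'a::comm_ring_1 fps"
  assumes "p \<ge> 1"
  shows "((f oo fps_X ^ p) * g) $ n = (\<Sum>k=0..n div p. f $ k * g $ (n - p * k))"
proof -
  have "((f oo fps_X ^ p) * g) $ n
      = (\<Sum>i=0..n. (if p dvd i then f $ (i div p) else 0) * g $ (n - i))"
    by (simp add: fps_mult_nth fps_compose_X_power_nth [OF assms])
  also have "\<dots> = (\<Sum>i\<in>(*) p ` {0..n div p}. (if p dvd i then f $ (i div p) else 0) * g $ (n - i))"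
  proof (rule sum.mono_neutral_right)
    show "(*) p ` {0..n div p} \<subseteq> {0..n}"
      using assms by (auto simp: less_eq_div_iff_mult_less_eq mult.commute)
    show "\<forall>i\<in>{0..n} - (*) p ` {0..n div p}.
        (if p dvd i then f $ (i div p) else 0) * g $ (n - i) = 0"
    proof
      fix i assume i: "i \<in> {0..n} - (*) p ` {0..n div p}"
      have "\<not> p dvd i"
      proof
        assume "p dvd i"
        then have "i = p * (i div p)" by simp
        moreover have "i div p \<in> {0..n div p}" using i by (auto intro: div_le_mono)
        ultimately show False using i by blast
      qed
      then show "(if p dvd i then f $ (i div p) else 0) * g $ (n - i) = 0" by simp
    qed
  qed simp
  also have "\<dots> = (\<Sum>k=0..n div p. f $ k * g $ (n - p * k))"
    using assms by (subst sum.reindex) (auto simp: inj_on_def)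
  finally show ?thesis .
qed

lemma fps_const_sum: "fps_const (\<Sum>x\<in>A. f x) = (\<Sum>x\<in>A. fps_const (f x))"
  by (rule fps_ext) (simp add: fps_sum_nth)

text \<open>The binomial theorem divided by \<open>fact n\<close>, read off from exp(a x) exp(b x) =
  exp((a + b) x).\<close>

lemma sum_exp_coeff_mult:
  fixes a b :: complex
  shows "(\<Sum>i=0..n. a ^ i / fact i * (b ^ (n - i) / fact (n - i))) = (a + b) ^ n / fact n"
  using arg_cong [OF fps_exp_add_mult [of a b], of "\<lambda>f. f $ n"]
  by (simp add: fps_mult_nth)

text \<open>
  The outer variable is \<open>u\<close>, the inner one \<open>v\<close>. The factor \<open>exp (\<gamma> u\<^sup>p v\<^sup>q)\<close> is the
  exponential of \<open>\<gamma> u v\<^sup>q\<close> with \<open>u\<^sup>p\<close> substituted for \<open>u\<close>.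
\<close>

definition outer_exp :: "complex fps \<Rightarrow> complex \<Rightarrow> complex fps fps" where
  "outer_exp M c = Abs_fps (\<lambda>k. fps_const (c ^ k / fact k) * M ^ k)"

definition H_gf :: "nat \<Rightarrow> nat \<Rightarrow> complex \<Rightarrow> complex \<Rightarrow> complex \<Rightarrow> complex fps fps" where
  "H_gf p q z w \<gamma> =
     (outer_exp (fps_X ^ q) \<gamma> oo fps_X ^ p) * (outer_exp 1 z * fps_const (fps_exp w))"

text \<open>The series is exp(c M u). In degree \<open>n\<close> every summand of the product
  carries the same factor \<open>M ^ n\<close>, so only the scalar binomial identity
  remains.\<close>

lemma outer_exp_add: "outer_exp M (a + b) = outer_exp M a * outer_exp M b"
proof (rule fps_ext)
  fix n
  have "(outer_exp M a * outer_exp M b) $ n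
      = (\<Sum>i=0..n. fps_const (a ^ i / fact i * (b ^ (n - i) / fact (n - i))) * M ^ n)"
    unfolding outer_exp_def fps_mult_nth fps_nth_Abs_fps
  proof (rule sum.cong)
    fix i assume "i \<in> {0..n}"
    then have "M ^ n = M ^ i * M ^ (n - i)" by (simp add: power_add [symmetric])
    then show "fps_const (a ^ i / fact i) * M ^ i * (fps_const (b ^ (n - i) / fact (n - i)) * M ^ (n - i))
        = fps_const (a ^ i / fact i * (b ^ (n - i) / fact (n - i))) * M ^ n"
      by (simp only: fps_const_mult [symmetric] mult_ac)
  qed simp
  also have "\<dots> = fps_const (\<Sum>i=0..n. a ^ i / fact i * (b ^ (n - i) / fact (n - i))) * M ^ n"
    by (simp only: sum_distrib_right [symmetric] fps_const_sum)
  also have "\<dots> = outer_exp M (a + b) $ n"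
    by (simp only: sum_exp_coeff_mult outer_exp_def fps_nth_Abs_fps)
  finally show "outer_exp M (a + b) $ n = (outer_exp M a * outer_exp M b) $ n" ..
qed

lemma H_gf_add:
  assumes "p \<ge> 1"
  shows "H_gf p q (z + z') (w + w') (\<gamma> + \<gamma>') = H_gf p q z w \<gamma> * H_gf p q z' w' \<gamma>'"
proof -
  \<comment> \<open>Substitution respects products when the substituted series has zero constant
    term; \<open>p \<ge> 1\<close> ensures this.\<close>
  have "fps_nth (fps_X ^ p :: complex fps fps) 0 = 0"
    using assms by (simp add: fps_X_power_nth)
  then show ?thesis
    by (simp add: H_gf_def outer_exp_add fps_exp_add_mult fps_compose_mult_distrib
        fps_const_mult [symmetric] mult_ac del: fps_const_mult)
qed

lemma H_gf_nth:
  assumes "p \<ge> 1" and "q \<ge> 1"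
  shows "H_gf p q z w \<gamma> $ n $ m = H p q n m z w \<gamma> / (fact n * fact m)"
proof -
  let ?t = "\<lambda>k. \<gamma> ^ k / fact k * (z ^ (n - p * k) / fact (n - p * k))
                 * (w ^ (m - q * k) / fact (m - q * k))"
  have "H_gf p q z w \<gamma> $ n =
      (\<Sum>k=0..n div p. fps_const (\<gamma> ^ k / fact k * (z ^ (n - p * k) / fact (n - p * k)))
         * (fps_X ^ (q * k) * fps_exp w))"
    unfolding H_gf_def fps_mult_compose_X_power_nth [OF assms(1)] fps_const_mult [symmetric]
    by (intro sum.cong)
      (simp_all add: outer_exp_def power_mult [of fps_X q, symmetric] mult_ac del: fps_const_mult)
  \<comment> \<open>The factor \<open>fps_X ^ (q * k)\<close> kills the terms with
    \<open>m < q * k\<close>, which cuts the range down to the minimum in \<open>H\<close>.\<close>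
  then have "H_gf p q z w \<gamma> $ n $ m = (\<Sum>k=0..n div p. if m < q * k then 0 else ?t k)"
    by (simp only: fps_sum_nth fps_mult_left_const_nth fps_X_power_mult_nth fps_exp_nth)
      (auto intro!: sum.cong)
  also have "\<dots> = (\<Sum>k=0..min (n div p) (m div q). ?t k)"
    using assms(2)
    by (intro sum.mono_neutral_cong_right)
      (auto simp: less_eq_div_iff_mult_less_eq mult.commute not_le not_less)
  finally show ?thesis
    by (simp add: H_def)
qed

text \<open>Coefficient comparison in \<open>H_gf_add\<close>; the factorials combine into the two
  binomial coefficients.\<close>

lemma H_add:
  assumes "p \<ge> 1" and "q \<ge> 1"
  shows "H p q n m (z + z') (w + w') (\<gamma> + \<gamma>') =
    (\<Sum>k=0..n. \<Sum>j=0..m. of_nat (n choose k) * of_nat (m choose j)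
       * H p q k j z w \<gamma> * H p q (n - k) (m - j) z' w' \<gamma>')"
proof -
  have "H p q n m (z + z') (w + w') (\<gamma> + \<gamma>')
      = fact n * fact m * (H_gf p q z w \<gamma> * H_gf p q z' w' \<gamma>') $ n $ m"
    by (simp add: H_gf_add [OF assms(1), symmetric] H_gf_nth [OF assms])
  also have "\<dots> = (\<Sum>k=0..n. \<Sum>j=0..m. fact n * fact m *
      (H p q k j z w \<gamma> / (fact k * fact j)
       * (H p q (n - k) (m - j) z' w' \<gamma>' / (fact (n - k) * fact (m - j)))))"
    by (simp add: fps_mult_nth fps_sum_nth H_gf_nth [OF assms] sum_distrib_left)
  also have "\<dots> = (\<Sum>k=0..n. \<Sum>j=0..m. of_nat (n choose k) * of_nat (m choose j)
       * H p q k j z w \<gamma> * H p q (n - k) (m - j) z' w' \<gamma>')"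
    by (intro sum.cong) (simp_all add: binomial_fact mult_ac)
  finally show ?thesis .
qed

text \<open>Weighted homogeneity: if \<open>z\<close>, \<open>w\<close>, \<open>\<gamma>\<close>
  scale by \<open>s\<close>, \<open>t\<close>, \<open>s ^ p * t ^ q\<close>, each term of the sum
  scales by \<open>s ^ n * t ^ m\<close>.\<close>

lemma H_rescale:
  assumes "p \<ge> 1" and "q \<ge> 1" and "s \<noteq> 0" and "t \<noteq> 0"
  shows "H p q n m (z / s) (w / t) \<gamma> = H p q n m z w (s ^ p * t ^ q * \<gamma>) / (s ^ n * t ^ m)"
proof -
  have "\<gamma> ^ k / fact k * ((z / s) ^ (n - p * k) / fact (n - p * k))
          * ((w / t) ^ (m - q * k) / fact (m - q * k))
      = (s ^ p * t ^ q * \<gamma>) ^ k / fact k * (z ^ (n - p * k) / fact (n - p * k))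
          * (w ^ (m - q * k) / fact (m - q * k)) / (s ^ n * t ^ m)"
    if "k \<in> {0..min (n div p) (m div q)}" for k
  proof -
    have "p * k \<le> n" "q * k \<le> m"
      using that assms by (auto simp: less_eq_div_iff_mult_less_eq mult.commute)
    \<comment> \<open>The summation range makes both natural-number subtractions exact.\<close>
    then have "s ^ n = (s ^ p) ^ k * s ^ (n - p * k)" "t ^ m = (t ^ q) ^ k * t ^ (m - q * k)"
      by (simp_all add: power_mult [symmetric] power_add [symmetric])
    then show ?thesis
      using assms(3,4) by (simp add: power_mult_distrib power_divide field_simps)
  qed
  then have "(\<Sum>k=0..min (n div p) (m div q). \<gamma> ^ k / fact k
          * ((z / s) ^ (n - p * k) / fact (n - p * k)) * ((w / t) ^ (m - q * k) / fact (m - q * k)))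
      = (\<Sum>k=0..min (n div p) (m div q). (s ^ p * t ^ q * \<gamma>) ^ k / fact k
          * (z ^ (n - p * k) / fact (n - p * k)) * (w ^ (m - q * k) / fact (m - q * k)))
        / (s ^ n * t ^ m)"
    unfolding sum_divide_distrib by (rule sum.cong [OF refl])
  then show ?thesis
    by (simp only: H_def times_divide_eq_right)
qed

theorem corollary4p4:
  fixes p q n m :: nat and z z' w w' \<gamma> :: complex
  assumes "p \<ge> 1" and "q \<ge> 1"
  shows "H p q n m
           ((z + z') / complex_of_real (2 powr (1 / (2 * real p))))
           ((w + w') / complex_of_real (2 powr (1 / (2 * real q)))) \<gamma>
       = complex_of_real (2 powr (- (real n / (2 * real p) + real m / (2 * real q))))
         * (\<Sum>k=0..n. \<Sum>j=0..m.
              of_nat (n choose k) * of_nat (m choose j)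
              * H p q k j z w \<gamma> * H p q (n - k) (m - j) z' w' \<gamma>)"
proof -
  define s where "s = (2::real) powr (1 / (2 * real p))"
  define t where "t = (2::real) powr (1 / (2 * real q))"
  have pow: "s ^ i = 2 powr (real i / (2 * real p))" "t ^ i = 2 powr (real i / (2 * real q))" for i
    by (simp_all add: s_def t_def powr_realpow [symmetric] powr_powr)
  \<comment> \<open>Both \<open>s ^ p\<close> and \<open>t ^ q\<close> equal the square root of
    2.\<close>
  have "s ^ p * t ^ q = 2"
    using assms by (simp add: pow powr_add [symmetric])
  then have two: "complex_of_real s ^ p * complex_of_real t ^ q = 2"
    by (metis of_real_mult of_real_numeral of_real_power)
  have "2 powr (- (real n / (2 * real p) + real m / (2 * real q))) = 1 / (s ^ n * t ^ m)"
    by (simp only: pow powr_add [symmetric] powr_minus_divide)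
  then have scale: "complex_of_real (2 powr (- (real n / (2 * real p) + real m / (2 * real q))))
      = 1 / (complex_of_real s ^ n * complex_of_real t ^ m)"
    by simp
  have "complex_of_real s \<noteq> 0" "complex_of_real t \<noteq> 0"
    by (simp_all add: s_def t_def)
  \<comment> \<open>The rescaled parameter is 2 \<open>\<gamma>\<close>, written as
    \<open>\<gamma> + \<gamma>\<close> to fit \<open>H_add\<close> with equal third
    parameters.\<close>
  from H_rescale [OF assms this, of n m "z + z'" "w + w'" \<gamma>]
  have "H p q n m ((z + z') / complex_of_real s) ((w + w') / complex_of_real t) \<gamma>
      = H p q n m (z + z') (w + w') (\<gamma> + \<gamma>) / (complex_of_real s ^ n * complex_of_real t ^ m)"
    by (simp only: two mult_2)
  then show ?thesis
    unfolding s_def [symmetric] t_def [symmetric] scale H_add [OF assms] by simp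
qed

end
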